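(* Let $k<n$ be positive integers. The large selective height of an $l$-generated PI-algebra satisfying an admissible polynomial identity of degree $n$, over the set of non-cyclic words of length $k$, is less than $2(n-1)\,\beth(k,l,n)$.
   Context: Algebras are associative; an admissible polynomial identity of degree $n$ is one in which some monomial of highest degree $n$ has coefficient $1$. Words are over the alphabet of generators $a_1<\dots<a_l$, compared lexicographically; two words are incomparable if one is a prefix of the other, comparable otherwise. A word is non-cyclic if it is not a proper power $v^r$, $r>1$. Two words are strongly comparable if all their cyclic shifts are comparable (for words of equal length: they are not cyclic shifts of each other). A word $W$ is $n$-divisible if $W=W_0W_1\cdots W_n$ with $W_1,\dots,W_n$ in lexicographically decreasing order. Large selective height (threshold $2n$) of a word $W$ over a set $Z$ of words of one fixed length: the maximal $h$ such that $W$ contains $h$ pairwise disjoint subwords of the form $z^m$, $z\in Z$, $m>2n$, such that the periods of neighbouring subwords of this selection are not cyclic shifts of each other. For a set of words it is the supremum over its elements; for an algebra as in the claim it is that of the set of non-$n$-divisible words in the generators. Definition of $\beth(t,l,n)$ (with $t<n$): a word-cycle is a word together with all its cyclic shifts. A class $X(t,l)$ is any set of pairwise strongly comparable word-cycles of non-cyclic words of length $t$ over the alphabet $a_1<\dots<a_l$, numbered by natural numbers starting from $1$, with the following partial order on the words belonging to these word-cycles: $u\prec v$ if $u$ is lexicographically smaller than $v$ and the word-cycle containing $u$ has a smaller number than the word-cycle containing $v$. The class is $n$-good if it contains no antichain of $n$ words. Then $\beth(t,l,n)$ is the maximal possible number of elements (word-cycles) in an $n$-good class $X(t,l)$.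
   Formalization: It is additionally assumed that non-cyclic words of length k over the l generators exist (l at least 2, or l = 1 and k = 1); otherwise the height and ℶ(k,l,n) are both 0 and the strict inequality fails. *)

theory Defs
  imports Main "HOL-Library.Sublist" "HOL-Library.Extended_Nat" "HOL-Library.Poly_Mapping"
begin

section \<open>Associative algebras with an admissible polynomial identity\<close>

text \<open>Algebras need not be unital; the scalars form an arbitrary commutative ring with \<open>1 \<noteq> 0\<close>.\<close>

locale assoc_algebra = module scale
  for scale :: "'k::comm_ring_1 \<Rightarrow> 'a::ring \<Rightarrow> 'a" +
  assumes scale_mult_left: "scale c x * y = scale c (x * y)"
    and scale_mult_right: "x * scale c y = scale c (x * y)"

definition generated_by :: "('k::comm_ring_1 \<Rightarrow> 'a::ring \<Rightarrow> 'a) \<Rightarrow> 'a set \<Rightarrow> bool" where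
  "generated_by scale G \<longleftrightarrow>
     (\<forall>S. module.subspace scale S \<and> (\<forall>x\<in>S. \<forall>y\<in>S. x * y \<in> S) \<and> G \<subseteq> S \<longrightarrow> S = UNIV)"

text \<open>
  A non-commutative polynomial in the variables \<open>x\<^sub>0, x\<^sub>1, \<dots>\<close> is a finitely supported function on
  words of variable indices. As there need not be a unit, polynomials have no constant term;
  the value of the empty monomial is irrelevant.
\<close>

fun monomial_value :: "(nat \<Rightarrow> 'a::ring) \<Rightarrow> nat list \<Rightarrow> 'a" where
  "monomial_value x [] = 0"
| "monomial_value x [i] = x i"
| "monomial_value x (i # j # w) = x i * monomial_value x (j # w)"

definition poly_value ::
  "('k::comm_ring_1 \<Rightarrow> 'a::ring \<Rightarrow> 'a) \<Rightarrow> (nat \<Rightarrow> 'a) \<Rightarrow> (nat list \<Rightarrow>\<^sub>0 'k) \<Rightarrow> 'a" where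
  "poly_value scale x f = (\<Sum>w\<in>Poly_Mapping.keys f. scale (Poly_Mapping.lookup f w) (monomial_value x w))"

definition admissible_poly :: "nat \<Rightarrow> (nat list \<Rightarrow>\<^sub>0 'k::comm_ring_1) \<Rightarrow> bool" where
  "admissible_poly n f \<longleftrightarrow>
     [] \<notin> Poly_Mapping.keys f \<and>
     (\<forall>w\<in>Poly_Mapping.keys f. length w \<le> n) \<and>
     (\<exists>w. length w = n \<and> Poly_Mapping.lookup f w = 1)"

definition satisfies_identity ::
  "('k::comm_ring_1 \<Rightarrow> 'a::ring \<Rightarrow> 'a) \<Rightarrow> (nat list \<Rightarrow>\<^sub>0 'k) \<Rightarrow> bool" where
  "satisfies_identity scale f \<longleftrightarrow> (\<forall>x. poly_value scale x f = 0)"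

section \<open>Words\<close>

text \<open>
  The letter \<open>i \<in> {1..l}\<close> stands for the generator \<open>a\<^sub>i\<close>; words are formal, i.e. not
  identified when their values in the algebra coincide.
\<close>

definition words :: "nat \<Rightarrow> nat list set" where
  "words l = lists {1..l}"

definition comparable :: "nat list \<Rightarrow> nat list \<Rightarrow> bool" where
  "comparable u v \<longleftrightarrow> \<not> prefix u v \<and> \<not> prefix v u"

text \<open>Unlike in \<open>lexord\<close>, a proper prefix is not smaller than the word it begins.\<close>

definition lex_less :: "nat list \<Rightarrow> nat list \<Rightarrow> bool" where
  "lex_less u v \<longleftrightarrow> comparable u v \<and> (u, v) \<in> lexord less_than"

definition word_power :: "nat list \<Rightarrow> nat \<Rightarrow> nat list" where
  "word_power v r = concat (replicate r v)"

definition noncyclic :: "nat list \<Rightarrow> bool" where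
  "noncyclic w \<longleftrightarrow> \<not> (\<exists>v r. r > 1 \<and> w = word_power v r)"

definition noncyclic_words :: "nat \<Rightarrow> nat \<Rightarrow> nat list set" where
  "noncyclic_words t l = {w \<in> words l. length w = t \<and> noncyclic w}"

definition word_cycle :: "nat list \<Rightarrow> nat list set" where
  "word_cycle w = range (\<lambda>i. rotate i w)"

definition strongly_comparable :: "nat list \<Rightarrow> nat list \<Rightarrow> bool" where
  "strongly_comparable u v \<longleftrightarrow> (\<forall>u'\<in>word_cycle u. \<forall>v'\<in>word_cycle v. comparable u' v')"

definition n_divisible :: "nat \<Rightarrow> nat list \<Rightarrow> bool" where
  "n_divisible n W \<longleftrightarrow>
     (\<exists>W0 Ws. W = W0 @ concat Ws \<and> length Ws = n \<and> sorted_wrt (\<lambda>u v. lex_less v u) Ws)"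

section \<open>Large selective height\<close>

text \<open>
  A selection of \<open>h\<close> subwords is encoded by the factorization
  \<open>W = W\<^sub>0 z\<^sub>0\<^bsup>m\<^sub>0\<^esup> g\<^sub>0 z\<^sub>1\<^bsup>m\<^sub>1\<^esup> g\<^sub>1 \<dots>\<close>, in which the gaps may be empty.
\<close>

definition has_selection :: "nat \<Rightarrow> nat list set \<Rightarrow> nat list \<Rightarrow> nat \<Rightarrow> bool" where
  "has_selection n Z W h \<longleftrightarrow>
     (\<exists>W0 z m g.
        W = W0 @ concat (map (\<lambda>i. word_power (z i) (m i) @ g i) [0..<h]) \<and>
        (\<forall>i<h. z i \<in> Z \<and> m i > 2 * n) \<and>
        (\<forall>i. Suc i < h \<longrightarrow> z (Suc i) \<notin> word_cycle (z i)))"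

definition word_selective_height :: "nat \<Rightarrow> nat list set \<Rightarrow> nat list \<Rightarrow> enat" where
  "word_selective_height n Z W = (SUP h\<in>{h. has_selection n Z W h}. enat h)"

definition set_selective_height :: "nat \<Rightarrow> nat list set \<Rightarrow> nat list set \<Rightarrow> enat" where
  "set_selective_height n Z M = (SUP W\<in>M. word_selective_height n Z W)"

text \<open>
  By definition, the height of an \<open>l\<close>-generated algebra with an admissible identity of degree \<open>n\<close>
  is that of the set of non-\<open>n\<close>-divisible words, so it depends on the algebra only
  through \<open>l\<close> and \<open>n\<close>.
\<close>

definition algebra_selective_height :: "nat \<Rightarrow> nat \<Rightarrow> nat list set \<Rightarrow> enat" where
  "algebra_selective_height l n Z = set_selective_height n Z {W \<in> words l. \<not> n_divisible n W}"

section \<open>The function \<open>\<beth>\<close>\<close>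

text \<open>
  The numbering \<open>num\<close> is part of the data of a class, since the order depends on it.
  For equal-length words, strong comparability of different cycles in \<open>X\<close> is automatic.
\<close>

definition is_X :: "nat \<Rightarrow> nat \<Rightarrow> nat list set set \<Rightarrow> (nat list set \<Rightarrow> nat) \<Rightarrow> bool" where
  "is_X t l X num \<longleftrightarrow>
     X \<subseteq> word_cycle ` noncyclic_words t l \<and>
     pairwise (\<lambda>C D. \<forall>u\<in>C. \<forall>v\<in>D. strongly_comparable u v) X \<and>
     bij_betw num X {1..card X}"

definition cycle_prec :: "(nat list set \<Rightarrow> nat) \<Rightarrow> nat list \<Rightarrow> nat list \<Rightarrow> bool" where
  "cycle_prec num u v \<longleftrightarrow> lex_less u v \<and> num (word_cycle u) < num (word_cycle v)"

definition n_good :: "nat \<Rightarrow> nat list set set \<Rightarrow> (nat list set \<Rightarrow> nat) \<Rightarrow> bool" where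
  "n_good n X num \<longleftrightarrow>
     \<not> (\<exists>S. S \<subseteq> \<Union>X \<and> finite S \<and> card S = n \<and> (\<forall>u\<in>S. \<forall>v\<in>S. \<not> cycle_prec num u v))"

text \<open>The maximum is attained: a class has at most \<open>l ^ t\<close> elements, and the empty one is
  \<open>n\<close>-good for \<open>n > 0\<close>.\<close>

definition beth :: "nat \<Rightarrow> nat \<Rightarrow> nat \<Rightarrow> nat" where
  "beth t l n = Max {card X | X num. is_X t l X num \<and> n_good n X num}"

end

(*
  Let W be a word that is not n-divisible, with h selected powers. Each power except the last is
  followed by a break of its period, since the next period is not a cyclic shift of it; at the
  break the word becomes lexicographically larger or smaller than the periodic continuation x x x ....
  Powers x^r t ending in breaks upwards decrease as r grows, those ending in breaks downwards
  decrease as r falls, so one cycle has at most n - 1 upward and n - 2 downward breaks.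
  Numbering the cycles by the position of an occurrence in W makes them an n-good class: the
  members of an antichain, listed in decreasing order, occur disjointly in this order in W,
  because a power z^m with m > 2n contains all of its shifts in any order. So there are
  N <= beth cycles and h - 1 <= N (2n - 3). If N >= 2, this gives h < 2(n - 1)N; if N <= 1, then h <= 1.
*)

theory Submission imports Defs "HOL-Library.List_Lexorder" begin

section \<open>Lexicographic comparison of words\<close>

text \<open>Comparability places the first difference inside both words, so nothing appended on the
  right can change the outcome. All later comparisons of factors with unknown continuations rest on
  this.\<close>

lemma lex_less_append: "lex_less u v \<Longrightarrow> lex_less (u @ a) (v @ b)"
proof -
  assume uv: "lex_less u v"
  then have "(u, v) \<in> lexord less_than" "\<not> prefix u v" by (simp_all add: lex_less_def comparable_def)
  then obtain p c d u' v' where "(c, d) \<in> less_than" "u = p @ c # u'" "v = p @ d # v'"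
    by (auto simp: lexord_def)
  then have "(u @ a, v @ b) \<in> lexord less_than"
    by (simp add: lexord_append_leftI)
  moreover have "comparable (u @ a) (v @ b)"
    using uv unfolding lex_less_def comparable_def
    by (metis append_prefixD prefix_same_cases prefixI)
  ultimately show ?thesis by (simp add: lex_less_def)
qed

lemma lex_less_append_left: "lex_less u v \<Longrightarrow> lex_less (p @ u) (p @ v)"
  unfolding lex_less_def comparable_def
  by (auto simp: lexord_append_leftI)

lemma lex_less_total:
  assumes "comparable u v"
  shows "lex_less u v \<or> lex_less v u"
proof -
  have "u \<noteq> v" using assms by (auto simp: comparable_def)
  moreover have "total (lexord less_than)" by (rule total_lexord) (auto simp: total_on_def)
  ultimately show ?thesis using assms
    by (auto simp: lex_less_def comparable_def total_on_def)
qed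

lemma comparable_same_length: "length u = length v \<Longrightarrow> u \<noteq> v \<Longrightarrow> comparable u v"
  by (auto simp: comparable_def prefix_def)

section \<open>Powers and cyclic shifts of words\<close>

lemma word_power_0 [simp]: "word_power x 0 = []"
  by (simp add: word_power_def)

lemma word_power_Suc [simp]: "word_power x (Suc r) = x @ word_power x r"
  by (simp add: word_power_def)

lemma word_power_add: "word_power x (r + s) = word_power x r @ word_power x s"
  by (simp add: word_power_def replicate_add)

lemma length_word_power [simp]: "length (word_power x r) = r * length x"
  by (induction r) auto

text \<open>Reading a power in another cyclic shift of its period costs one copy.\<close>

lemma word_power_rotate: "word_power (b @ a) (Suc r) = b @ word_power (a @ b) r @ a"
  by (induction r) auto

lemma nth_word_power:
  "i < r * length x \<Longrightarrow> word_power x r ! i = x ! (i mod length x)"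
proof (induction r arbitrary: i)
  case (Suc r)
  show ?case
  proof (cases "i < length x")
    case True
    then show ?thesis by (simp add: nth_append)
  next
    case False
    then have "i mod length x = (i - length x) mod length x" by (intro le_mod_geq) simp
    moreover have "i - length x < r * length x" using Suc.prems False by simp
    ultimately show ?thesis using Suc.IH False by (simp add: nth_append)
  qed
qed simp

lemma word_cycle_self: "w \<in> word_cycle w"
  unfolding word_cycle_def by (rule range_eqI[of _ _ 0]) simp

lemma word_cycle_length: "u \<in> word_cycle w \<Longrightarrow> length u = length w"
  by (auto simp: word_cycle_def)

lemma word_cycle_split:
  assumes "u \<in> word_cycle w"
  obtains a b where "w = a @ b" "u = b @ a"
proof -
  obtain i where "u = rotate i w" using assms by (auto simp: word_cycle_def)
  then show thesis
    using that[of "take (i mod length w) w" "drop (i mod length w) w"]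
    by (simp add: rotate_drop_take)
qed

lemma word_cycle_append: "b @ a \<in> word_cycle (a @ b)"
  unfolding word_cycle_def by (metis rangeI rotate_append)

lemma word_cycle_eq:
  assumes "u \<in> word_cycle w"
  shows "word_cycle u = word_cycle w"
proof -
  have sub: "word_cycle u \<subseteq> word_cycle w" if "u \<in> word_cycle w" for u w
    using that by (auto simp: word_cycle_def rotate_rotate)
  have "w \<in> word_cycle u"
    using assms by (metis word_cycle_split word_cycle_append)
  then show ?thesis using sub assms by blast
qed

lemma finite_word_cycle: "finite (word_cycle w)"
  and card_word_cycle: "w \<noteq> [] \<Longrightarrow> card (word_cycle w) \<le> length w"
proof -
  have *: "word_cycle w \<subseteq> (\<lambda>i. rotate i w) ` {..<length w}" if "w \<noteq> []"
  proof
    fix u assume "u \<in> word_cycle w"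
    then obtain i where "u = rotate i w" by (auto simp: word_cycle_def)
    then have "u = rotate (i mod length w) w" using rotate_conv_mod by metis
    then show "u \<in> (\<lambda>i. rotate i w) ` {..<length w}" using that by auto
  qed
  show "finite (word_cycle w)"
    using finite_subset[OF *] by (cases "w = []") (simp_all add: word_cycle_def)
  show "card (word_cycle w) \<le> length w" if "w \<noteq> []"
    using card_mono[OF _ *[OF that]] card_image_le[of "{..<length w}" "\<lambda>i. rotate i w"] by simp
qed

section \<open>Disjoint factors in a given order and divisibility\<close>

text \<open>Arbitrary gaps are allowed, unlike in \<open>n_divisible\<close>. This makes the notion
  stable under enlarging the word and dropping factors, so factors can be chosen block by
  block.\<close>

fun occur_in_order :: "'a list list \<Rightarrow> 'a list \<Rightarrow> bool" where
  "occur_in_order [] W \<longleftrightarrow> True"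
| "occur_in_order (v # vs) W \<longleftrightarrow> (\<exists>p q. W = p @ v @ q \<and> occur_in_order vs q)"

lemma occur_in_order_prepend: "occur_in_order vs W \<Longrightarrow> occur_in_order vs (p @ W)"
  by (cases vs) (auto, metis append_assoc)

lemma occur_in_order_Cons: "occur_in_order vs q \<Longrightarrow> occur_in_order (v # vs) (p @ v @ q)"
  by auto

lemma occur_in_order_append:
  "occur_in_order us U \<Longrightarrow> occur_in_order vs V \<Longrightarrow> occur_in_order (us @ vs) (U @ V)"
proof (induction us arbitrary: U)
  case Nil
  then show ?case by (simp add: occur_in_order_prepend)
next
  case (Cons u us)
  then show ?case by (metis append_Cons append_assoc occur_in_order.simps(2))
qed

lemma occur_in_order_extend: "occur_in_order vs W \<Longrightarrow> occur_in_order vs (W @ q)"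
  using occur_in_order_append[of vs W "[]" q] by simp

lemma occur_in_order_subseq:
  "subseq us vs \<Longrightarrow> occur_in_order vs W \<Longrightarrow> occur_in_order us W"
proof (induction us vs arbitrary: W rule: list_emb.induct)
  case (list_emb_Cons xs ys y)
  then show ?case by (metis occur_in_order.simps(2) occur_in_order_prepend append_assoc)
qed auto

lemma occur_in_order_concat: "occur_in_order Bs (concat Bs)"
  by (induction Bs) (auto intro: exI[of _ "[]"])

lemma occur_in_order_refine:
  "list_all2 occur_in_order vss Bs \<Longrightarrow> occur_in_order Bs W \<Longrightarrow> occur_in_order (concat vss) W"
proof (induction arbitrary: W rule: list_all2_induct)
  case (Cons vs vss B Bs)
  then obtain p q where "W = p @ B @ q" "occur_in_order Bs q" by auto
  then show ?case
    using Cons by (simp add: occur_in_order_prepend occur_in_order_append)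
qed simp

text \<open>Each gap is appended to the factor on its left, which makes the factors adjacent; by
  \<open>lex_less_append\<close> their order survives.\<close>

lemma occur_in_order_n_divisible:
  assumes "occur_in_order vs W" "sorted_wrt (\<lambda>u v. lex_less v u) vs"
  shows "n_divisible (length vs) W"
proof -
  have "\<exists>W0 Ws. W = W0 @ concat Ws \<and> list_all2 prefix vs Ws"
    using assms(1)
  proof (induction vs arbitrary: W)
    case Nil
    then show ?case by (intro exI[of _ W] exI[of _ "[]"]) simp
  next
    case (Cons v vs)
    then obtain p q where W: "W = p @ v @ q" "occur_in_order vs q" by auto
    then obtain q0 Ws where q: "q = q0 @ concat Ws" "list_all2 prefix vs Ws"
      using Cons.IH by blast
    show ?case
      by (rule exI[of _ p], rule exI[of _ "(v @ q0) # Ws"]) (use W q in auto)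
  qed
  then obtain W0 Ws where W: "W = W0 @ concat Ws" and pre: "list_all2 prefix vs Ws" by blast
  have "sorted_wrt (\<lambda>u v. lex_less v u) Ws"
    unfolding sorted_wrt_iff_nth_less
  proof (intro allI impI)
    fix i j assume ij: "i < j" "j < length Ws"
    have len: "length vs = length Ws" using pre by (rule list_all2_lengthD)
    have "lex_less (vs ! j) (vs ! i)"
      using assms(2) ij len by (simp add: sorted_wrt_iff_nth_less)
    moreover have "prefix (vs ! i) (Ws ! i)" "prefix (vs ! j) (Ws ! j)"
      using pre ij len by (auto simp: list_all2_conv_all_nth)
    ultimately show "lex_less (Ws ! j) (Ws ! i)"
      by (auto simp: prefix_def intro: lex_less_append)
  qed
  then show ?thesis
    unfolding n_divisible_def using W list_all2_lengthD[OF pre] by metis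
qed

section \<open>Breaks of a period\<close>

text \<open>Copies of \<open>x\<close> are stripped from the front of \<open>y\<close> as long as
  possible. What remains is either a prefix of \<open>x\<close>, or comparable with \<open>x\<close>
  and then serves as \<open>t\<close>.\<close>

lemma power_prefix_or_break:
  assumes "x \<noteq> []"
  shows "(\<exists>N. prefix y (word_power x N)) \<or> (\<exists>j t. prefix (word_power x j @ t) y \<and> comparable t x)"
proof (induction y rule: length_induct)
  case (1 y)
  show ?case
  proof (cases "prefix x y")
    case True
    then obtain y' where y: "y = x @ y'" by (auto simp: prefix_def)
    then have "length y' < length y" using assms by simp
    with 1 consider N where "prefix y' (word_power x N)"
      | j t where "prefix (word_power x j @ t) y'" "comparable t x"
      by blast
    then show ?thesis
    proof cases
      case 1
      then have "prefix y (word_power x (Suc N))" using y by simp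
      then show ?thesis by blast
    next
      case 2
      then have "prefix (word_power x (Suc j) @ t) y" using y by simp
      then show ?thesis using 2 by blast
    qed
  next
    case False
    show ?thesis
    proof (cases "prefix y x")
      case True
      then have "prefix y (word_power x 1)" by simp
      then show ?thesis by blast
    next
      case False
      with \<open>\<not> prefix x y\<close> have "prefix (word_power x 0 @ y) y \<and> comparable y x"
        by (simp add: comparable_def)
      then show ?thesis by blast
    qed
  qed
qed

text \<open>By periodicity, a window as long as \<open>x\<close> at offset \<open>length g\<close>
  is \<open>x\<close> rotated by that offset.\<close>

lemma power_factor_in_word_cycle:
  assumes "prefix (g @ z) (word_power x N)" "length z = length x"
  shows "z \<in> word_cycle x"
proof -
  obtain q where q: "word_power x N = g @ z @ q" using assms(1) by (auto simp: prefix_def)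
  have "length g + length x \<le> N * length x"
    using arg_cong[OF q, of length] assms(2) by simp
  then have "z ! i = rotate (length g) x ! i" if "i < length z" for i
    using that assms(2) nth_word_power[of "length g + i" N x]
    by (simp add: q nth_append nth_rotate add.commute)
  then have "z = rotate (length g) x" using assms(2) by (simp add: nth_equalityI)
  then show ?thesis by (simp add: word_cycle_def)
qed

text \<open>The run is read in the fixed representative \<open>x\<close> of its cycle, so that all
  runs of one cycle can be compared. The \<open>x\<close>-periodic reading must fail by the end of
  \<open>z'\<close>, as otherwise \<open>z'\<close> would be a shift of \<open>x\<close>. Only
  \<open>r\<close> of the \<open>Suc r\<close> copies are sure to survive the realignment.\<close>

lemma run_break:
  assumes z: "z \<in> word_cycle x" and z': "z' \<notin> word_cycle x" "length z' = length x"
    and "x \<noteq> []"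
  obtains b J t rest where "word_power z (Suc r) @ g @ z' = b @ word_power x (r + J) @ t @ rest"
    and "comparable t x"
proof -
  obtain a b where ab: "x = a @ b" "z = b @ a" using z by (rule word_cycle_split)
  have "\<not> prefix (a @ g @ z') (word_power x N)" for N
    using power_factor_in_word_cycle[of "a @ g" z' x N] z' by auto
  then obtain j t where "prefix (word_power x j @ t) (a @ g @ z')" "comparable t x"
    using power_prefix_or_break[OF \<open>x \<noteq> []\<close>] by blast
  then obtain rest where rest: "a @ g @ z' = word_power x j @ t @ rest" and "comparable t x"
    by (auto simp: prefix_def)
  have "word_power z (Suc r) @ g @ z' = b @ word_power x r @ a @ g @ z'"
    using word_power_rotate[of b a r] ab by simp
  also have "\<dots> = b @ word_power x (r + j) @ t @ rest"
    by (simp add: rest word_power_add)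
  finally show thesis using that \<open>comparable t x\<close> by blast
qed

text \<open>After the common \<open>x^i\<close>, the comparison is decided between \<open>t\<close>
  and the next copy of \<open>x\<close>, whatever \<open>t'\<close> is.\<close>

lemma tail_less_power:
  assumes "lex_less t x" "i < j"
  shows "lex_less (word_power x i @ t) (word_power x j @ t')"
proof -
  obtain d where "j = i + Suc d" using assms(2) less_imp_Suc_add by fastforce
  then have "word_power x j = word_power x i @ x @ word_power x d"
    by (simp only: word_power_add word_power_Suc)
  then show ?thesis
    using lex_less_append_left[OF lex_less_append[OF assms(1), of "[]" "word_power x d @ t'"], of "word_power x i"]
    by simp
qed

lemma power_less_tail:
  assumes "lex_less x t" "i < j"
  shows "lex_less (word_power x j @ t') (word_power x i @ t)"
proof -
  obtain d where "j = i + Suc d" using assms(2) less_imp_Suc_add by fastforce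
  then have "word_power x j = word_power x i @ x @ word_power x d"
    by (simp only: word_power_add word_power_Suc)
  then show ?thesis
    using lex_less_append_left[OF lex_less_append[OF assms(1), of "word_power x d @ t'" "[]"], of "word_power x i"]
    by simp
qed

section \<open>Counting the breaks of one cycle in each direction\<close>

lemma subseq_blocks:
  assumes "sorted_wrt (<) is" "set is \<subseteq> {..<H}"
  shows "subseq (map B is) (map B [0..<H])"
proof -
  have "sorted is" "distinct is" using assms(1) by (simp_all add: strict_sorted_iff)
  moreover have "sorted (filter (\<lambda>i. i \<in> set is) [0..<H])" by (simp add: sorted_wrt_filter)
  moreover have "set is = set (filter (\<lambda>i. i \<in> set is) [0..<H])" using assms(2) by auto
  ultimately have "is = filter (\<lambda>i. i \<in> set is) [0..<H]"
    by (intro sorted_distinct_set_unique) simp_all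
  moreover have "subseq (filter (\<lambda>i. i \<in> set is) [0..<H]) [0..<H]" by simp
  ultimately have "subseq is [0..<H]" by (rule ssubst)
  then show ?thesis by (rule subseq_map)
qed

lemma obtain_sorted_indices:
  assumes "n \<le> card I" "finite (I::nat set)"
  obtains js where "length js = n" "sorted_wrt (<) js" "set js \<subseteq> I"
proof
  let ?s = "sorted_list_of_set I"
  show "length (take n ?s) = n" using assms by simp
  show "sorted_wrt (<) (take n ?s)" by (simp add: sorted_wrt_take)
  show "set (take n ?s) \<subseteq> I" using assms set_take_subset[of n ?s] by simp
qed

text \<open>From \<open>n\<close> such blocks, counted from 0, the \<open>j\<close>-th supplies
  \<open>x^j\<close> followed by its own \<open>t\<close>. By \<open>power_less_tail\<close> these
  \<open>n\<close> words decrease from left to right.\<close>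

lemma few_upper_breaks:
  assumes "\<not> n_divisible n (concat (map B [0..<H]))"
    and "I \<subseteq> {..<H}"
    and B: "\<And>i. i \<in> I \<Longrightarrow> \<exists>b t rest. B i = b @ word_power x n @ t @ rest \<and> lex_less x t"
  shows "card I < n"
proof (rule ccontr)
  assume "\<not> card I < n"
  then have "n \<le> card I" by simp
  moreover have "finite I" using assms(2) finite_subset by blast
  ultimately obtain js where js: "length js = n" "sorted_wrt (<) js" "set js \<subseteq> I"
    by (rule obtain_sorted_indices)
  have "\<exists>t. lex_less x t \<and> (\<forall>r\<le>n. occur_in_order [word_power x r @ t] (B i))"
    if i: "i \<in> I" for i
  proof -
    obtain b t rest where *: "B i = b @ word_power x n @ t @ rest" "lex_less x t"
      using B[OF i] by blast
    have "occur_in_order [word_power x r @ t] (B i)" if "r \<le> n" for r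
    proof -
      \<comment> \<open>The last \<open>r\<close> copies of \<open>x\<close> are joined to
        \<open>t\<close>, so each block offers every exponent up to \<open>n\<close>.\<close>
      have "B i = (b @ word_power x (n - r)) @ (word_power x r @ t) @ rest"
        using * that word_power_add[of x "n - r" r] by simp
      then show ?thesis
        by (simp only:) (intro occur_in_order_Cons occur_in_order.simps(1)[THEN iffD2] TrueI)
    qed
    then show ?thesis using * by blast
  qed
  then have "\<forall>i\<in>I. \<exists>t. lex_less x t \<and> (\<forall>r\<le>n. occur_in_order [word_power x r @ t] (B i))"
    by blast
  from bchoice[OF this] obtain t where t: "\<And>i. i \<in> I \<Longrightarrow> lex_less x (t i)"
      "\<And>i r. i \<in> I \<Longrightarrow> r \<le> n \<Longrightarrow> occur_in_order [word_power x r @ t i] (B i)" by blast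
  define v where "v j = word_power x j @ t (js ! j)" for j
  have jI: "js ! j \<in> I" if "j < n" for j using js that by auto
  have "occur_in_order (map B js) (concat (map B [0..<H]))"
    using js assms(2)
    by (intro occur_in_order_subseq[OF subseq_blocks occur_in_order_concat]) auto
  moreover have "list_all2 occur_in_order (map (\<lambda>j. [v j]) [0..<n]) (map B js)"
    unfolding v_def list_all2_conv_all_nth using js jI t(2) by simp
  ultimately have "occur_in_order (map v [0..<n]) (concat (map B [0..<H]))"
    using occur_in_order_refine[of "map (\<lambda>j. [v j]) [0..<n]"] by simp
  moreover have "sorted_wrt (\<lambda>u v. lex_less v u) (map v [0..<n])"
    by (auto simp: sorted_wrt_iff_nth_less v_def intro!: power_less_tail t jI)
  ultimately show False using occur_in_order_n_divisible assms(1) by fastforce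
qed

text \<open>
  The first run, besides \<open>x\<^sup>r t\<close>, contributes the still larger factor \<open>x\<^sup>n\<close> in front of it.
  Hence one break fewer suffices than in the previous lemma.
\<close>

lemma few_lower_breaks:
  assumes "\<not> n_divisible n (concat (map B [0..<H]))"
    and "I \<subseteq> {..<H}" and "2 \<le> n"
    and B: "\<And>i. i \<in> I \<Longrightarrow> \<exists>b t rest. B i = b @ word_power x (2 * n - 1) @ t @ rest \<and> lex_less t x"
  shows "card I < n - 1"
proof (rule ccontr)
  assume "\<not> card I < n - 1"
  then have "n - 1 \<le> card I" by simp
  moreover have "finite I" using assms(2) finite_subset by blast
  ultimately obtain js where js: "length js = n - 1" "sorted_wrt (<) js" "set js \<subseteq> I"
    by (rule obtain_sorted_indices)
  have "\<exists>t. lex_less t x \<and> (\<forall>r<n. occur_in_order [word_power x n, word_power x r @ t] (B i))"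
    if i: "i \<in> I" for i
  proof -
    obtain b t rest where *: "B i = b @ word_power x (2 * n - 1) @ t @ rest" "lex_less t x"
      using B[OF i] by blast
    have "occur_in_order [word_power x n, word_power x r @ t] (B i)" if "r < n" for r
    proof -
      \<comment> \<open>The exponent \<open>2 * n - 1\<close> leaves room for \<open>x^n\<close>
        and, disjoint from it, \<open>x^r t\<close> with any \<open>r\<close> up to
        \<open>n - 1\<close>.\<close>
      have "2 * n - 1 = n + ((n - 1 - r) + r)" using that by simp
      then have "B i = b @ word_power x n @ (word_power x (n - 1 - r) @ (word_power x r @ t) @ rest)"
        using * by (simp only: word_power_add append_assoc)
      then show ?thesis
        by (simp only:) (intro occur_in_order_Cons occur_in_order.simps(1)[THEN iffD2] TrueI)
    qed
    then show ?thesis using * by blast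
  qed
  then have "\<forall>i\<in>I. \<exists>t. lex_less t x
      \<and> (\<forall>r<n. occur_in_order [word_power x n, word_power x r @ t] (B i))"
    by blast
  from bchoice[OF this] obtain t where t: "\<And>i. i \<in> I \<Longrightarrow> lex_less (t i) x"
      "\<And>i r. i \<in> I \<Longrightarrow> r < n \<Longrightarrow> occur_in_order [word_power x n, word_power x r @ t i] (B i)"
    by blast
  \<comment> \<open>For breaks downwards the exponents must fall: they run from \<open>n - 2\<close>
    to 0 over the \<open>n - 1\<close> blocks.\<close>
  define v where "v j = word_power x (n - 2 - j) @ t (js ! j)" for j
  \<comment> \<open>Only the first block contributes two words, which brings the total to
    \<open>n\<close>.\<close>
  define vss where "vss j = (if j = 0 then [word_power x n] else []) @ [v j]" for j
  have jI: "js ! j \<in> I" if "j < n - 1" for j using js that by auto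
  have "occur_in_order (map B js) (concat (map B [0..<H]))"
    using js assms(2)
    by (intro occur_in_order_subseq[OF subseq_blocks occur_in_order_concat]) auto
  moreover have "occur_in_order (vss j) (B (js ! j))" if "j < n - 1" for j
  proof -
    have occ: "occur_in_order [word_power x n, v j] (B (js ! j))"
      unfolding v_def using that by (intro t(2) jI) auto
    have "subseq (vss j) [word_power x n, v j]" by (cases "j = 0") (simp_all add: vss_def)
    then show ?thesis using occ by (rule occur_in_order_subseq)
  qed
  then have "list_all2 occur_in_order (map vss [0..<n - 1]) (map B js)"
    unfolding list_all2_conv_all_nth using js by simp
  ultimately have "occur_in_order (concat (map vss [0..<n - 1])) (concat (map B [0..<H]))"
    by (rule occur_in_order_refine[rotated])
  moreover have "concat (map vss [0..<n - 1]) = word_power x n # map v [0..<n - 1]"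
  proof -
    have upt: "[0..<n - 1] = 0 # [1..<n - 1]"
      using upt_conv_Cons[of 0 "n - 1"] \<open>2 \<le> n\<close> by simp
    have "map vss [1..<n - 1] = map (\<lambda>j. [v j]) [1..<n - 1]" by (simp add: vss_def)
    then have "concat (map vss [1..<n - 1]) = map v [1..<n - 1]"
      by (simp only: concat_map_singleton)
    moreover have "vss 0 = [word_power x n, v 0]" by (simp add: vss_def)
    ultimately show ?thesis by (simp only: upt list.map concat.simps append.simps)
  qed
  moreover have "sorted_wrt (\<lambda>u v. lex_less v u) (map v [0..<n - 1])"
  proof -
    have "lex_less (v j) (v i)" if "i < j" "j < n - 1" for i j
      unfolding v_def using that by (intro tail_less_power t(1) jI) auto
    then show ?thesis by (simp add: sorted_wrt_iff_nth_less)
  qed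
  moreover have "lex_less (v j) (word_power x n)" if "j < n - 1" for j
    using tail_less_power[OF t(1)[OF jI[OF that]], of "n - 2 - j" n "[]"] \<open>2 \<le> n\<close>
    by (simp add: v_def)
  ultimately have "n_divisible (length (word_power x n # map v [0..<n - 1])) (concat (map B [0..<H]))"
    by (intro occur_in_order_n_divisible) simp_all
  then show False using assms(1) \<open>2 \<le> n\<close> by simp
qed

section \<open>Bounding the number of cycles by \<open>beth\<close>\<close>

text \<open>If \<open>z = a @ b\<close>, then \<open>z @ z\<close> is
  \<open>a @ (b @ a) @ b\<close>, so two copies of \<open>z\<close> suffice for each shift.\<close>

lemma occur_in_order_cyclic_shifts:
  "set us \<subseteq> word_cycle z \<Longrightarrow> occur_in_order us (word_power z (2 * length us))"
proof (induction us)
  case (Cons u us)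
  then obtain a b where ab: "z = a @ b" "u = b @ a"
    by (metis list.set_intros(1) subset_iff word_cycle_split)
  have "word_power z (2 * length (u # us)) = a @ u @ (b @ word_power z (2 * length us))"
    by (simp add: ab)
  then show ?case using Cons
    by (metis occur_in_order.simps(2) occur_in_order_prepend set_subset_Cons subset_trans)
qed simp

text \<open>Serves to distribute the words of an antichain over the runs that are to contain them.
  By sortedness, the entries with value below \<open>h\<close> form an initial segment, and the
  induction splits off the last fibre.\<close>

lemma concat_filter_fibres:
  assumes "sorted (map f vs)" "\<And>v. v \<in> set vs \<Longrightarrow> f v < h"
  shows "concat (map (\<lambda>i. filter (\<lambda>v. f v = i) vs) [0..<h]) = vs"
  using assms
proof (induction h arbitrary: vs)
  case (Suc h)
  define us where "us = takeWhile (\<lambda>v. f v < h) vs"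
  define ws where "ws = dropWhile (\<lambda>v. f v < h) vs"
  have vs: "vs = us @ ws" by (simp add: us_def ws_def)
  have us: "f v < h" if "v \<in> set us" for v using that set_takeWhileD unfolding us_def by fast
  have ws: "f v = h" if v: "v \<in> set ws" for v
  proof -
    obtain w ws' where w: "ws = w # ws'" using v by (cases ws) auto
    have "\<not> f w < h" using w hd_dropWhile[of "\<lambda>v. f v < h" vs] unfolding ws_def by force
    moreover have "f w \<le> f v" using Suc.prems(1) v w vs by (auto simp: sorted_append)
    moreover have "f v < Suc h" using Suc.prems(2) v vs by simp
    ultimately show ?thesis by simp
  qed
  have "map (\<lambda>i. filter (\<lambda>v. f v = i) vs) [0..<h] = map (\<lambda>i. filter (\<lambda>v. f v = i) us) [0..<h]"
    using ws by (auto simp: vs filter_empty_conv)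
  moreover have "concat (map (\<lambda>i. filter (\<lambda>v. f v = i) us) [0..<h]) = us"
    by (rule Suc.IH) (use Suc.prems us vs in \<open>auto simp: sorted_append\<close>)
  moreover have "filter (\<lambda>v. f v = h) vs = ws"
    using us ws by (auto simp: vs filter_id_conv filter_empty_conv)
  ultimately show ?case using vs by (simp only: upt_Suc_append map_append concat_append) simp
next
  case 0
  then have "set vs = {}" by (metis equals0I not_less_zero)
  then show ?case by simp
qed

lemma finite_noncyclic_words: "finite (noncyclic_words k l)"
proof -
  have "noncyclic_words k l \<subseteq> {xs. set xs \<subseteq> {1..l} \<and> length xs = k}"
    by (auto simp: noncyclic_words_def words_def)
  then show ?thesis using finite_lists_length_eq[of "{1..l}" k] finite_subset by blast
qed

lemma card_le_beth:
  assumes "is_X k l X num" "n_good n X num"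
  shows "card X \<le> beth k l n"
proof -
  \<comment> \<open>\<open>Max\<close> is a true maximum because all classes consist of cycles from
    one finite set.\<close>
  have "{card X | X num. is_X k l X num \<and> n_good n X num}
          \<subseteq> {..card (word_cycle ` noncyclic_words k l)}"
    by (auto simp: is_X_def intro!: card_mono finite_imageI finite_noncyclic_words)
  then have "finite {card X | X num. is_X k l X num \<and> n_good n X num}"
    using finite_subset by blast
  then show ?thesis unfolding beth_def by (rule Max_ge) (use assms in blast)
qed

text \<open>A single cycle has at most \<open>k < n\<close> words, too few for an antichain of
  \<open>n\<close> words.\<close>

lemma beth_pos:
  assumes "w \<in> noncyclic_words k l" "0 < k" "k < n"
  shows "0 < beth k l n"
proof -
  have "is_X k l {word_cycle w} (\<lambda>_. 1)"
    using assms by (auto simp: is_X_def bij_betw_def)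
  moreover have "n_good n {word_cycle w} (\<lambda>_. 1)"
  proof -
    have "card (word_cycle w) < n"
      using card_word_cycle[of w] assms by (force simp: noncyclic_words_def)
    then have "card S \<noteq> n" if "S \<subseteq> word_cycle w" for S
      using card_mono[OF finite_word_cycle that] by linarith
    then show ?thesis by (auto simp: n_good_def)
  qed
  ultimately show ?thesis using card_le_beth by fastforce
qed

text \<open>Different cycles share no word, since a common word would generate both; different words
  of equal length are comparable.\<close>

lemma strongly_comparable_cycles:
  assumes "X \<subseteq> word_cycle ` noncyclic_words k l"
  shows "pairwise (\<lambda>C D. \<forall>u\<in>C. \<forall>v\<in>D. strongly_comparable u v) X"
proof (rule pairwiseI, intro ballI)
  fix C D u v assume CD: "C \<in> X" "D \<in> X" "C \<noteq> D" and uv: "u \<in> C" "v \<in> D"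
  obtain c d where "C = word_cycle c" "c \<in> noncyclic_words k l"
      and "D = word_cycle d" "d \<in> noncyclic_words k l"
    using CD assms by blast
  then have cd: "C = word_cycle c" "D = word_cycle d" "length c = k" "length d = k"
    by (simp_all add: noncyclic_words_def)
  have cycles: "word_cycle u = C" "word_cycle v = D"
    using uv cd word_cycle_eq by blast+
  have len: "length w = k" if "w \<in> C \<union> D" for w
    using that cd word_cycle_length by (metis Un_iff)
  show "strongly_comparable u v"
    unfolding strongly_comparable_def cycles
  proof (intro ballI)
    fix u' v' assume "u' \<in> C" "v' \<in> D"
    then have "word_cycle u' = C" "word_cycle v' = D"
      using cycles word_cycle_eq[of u' u] word_cycle_eq[of v' v] by auto
    then have "u' \<noteq> v'" using CD(3) by auto
    then show "comparable u' v'"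
      using len \<open>u' \<in> C\<close> \<open>v' \<in> D\<close> by (intro comparable_same_length) auto
  qed
qed

lemma obtain_order_numbering:
  fixes f :: "'b \<Rightarrow> nat"
  assumes "finite X" "inj_on f X"
  obtains num where "bij_betw num X {1..card X}"
    and "\<And>C D. C \<in> X \<Longrightarrow> D \<in> X \<Longrightarrow> f C < f D \<Longrightarrow> num C < (num D :: nat)"
proof -
  \<comment> \<open>The rank of \<open>f C\<close> among the values of \<open>f\<close> on
    \<open>X\<close>: the values may have gaps, while a numbering must fill
    \<open>{1..card X}\<close>.\<close>
  define num where "num C = card {E \<in> X. f E \<le> f C}" for C
  have mono: "num C < num D" if "C \<in> X" "D \<in> X" "f C < f D" for C D
  proof -
    have "{E \<in> X. f E \<le> f C} \<subset> {E \<in> X. f E \<le> f D}"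
    proof (rule psubsetI)
      show "{E \<in> X. f E \<le> f C} \<subseteq> {E \<in> X. f E \<le> f D}" using that by auto
      have "D \<in> {E \<in> X. f E \<le> f D} - {E \<in> X. f E \<le> f C}" using that by simp
      then show "{E \<in> X. f E \<le> f C} \<noteq> {E \<in> X. f E \<le> f D}" by blast
    qed
    then show ?thesis unfolding num_def by (rule psubset_card_mono[rotated]) (simp add: assms)
  qed
  have inj: "inj_on num X"
  proof (rule inj_onI, rule ccontr)
    fix C D assume CD: "C \<in> X" "D \<in> X" "num C = num D" "C \<noteq> D"
    then have "f C \<noteq> f D" using assms(2) by (auto dest: inj_onD)
    then show False using mono[of C D] mono[of D C] CD by linarith
  qed
  moreover have "num ` X \<subseteq> {1..card X}"
    using assms(1) by (auto simp: num_def Suc_le_eq card_gt_0_iff intro!: card_mono)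
  then have "num ` X = {1..card X}"
    by (rule card_subset_eq[rotated]) (simp_all add: card_image[OF inj])
  ultimately show thesis using that[of num] mono by (simp add: bij_betw_def)
qed

lemma card_cycles_le_beth:
  assumes W: "W = W0 @ concat (map (\<lambda>i. word_power (z i) (m i) @ g i) [0..<h])"
    and z: "\<And>i. i < h \<Longrightarrow> z i \<in> noncyclic_words k l \<and> m i > 2 * n"
    and ndiv: "\<not> n_divisible n W"
  shows "card (word_cycle ` z ` {..<h}) \<le> beth k l n"
proof -
  define X where "X = word_cycle ` z ` {..<h}"
  have "\<exists>i<h. word_cycle (z i) = C" if "C \<in> X" for C using that by (auto simp: X_def)
  \<comment> \<open>One run is chosen for each cycle; its position determines the number of the
    cycle.\<close>
  then obtain idx where idx: "\<And>C. C \<in> X \<Longrightarrow> idx C < h \<and> word_cycle (z (idx C)) = C" by metis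
  have "inj_on idx X" by (rule inj_onI) (metis idx)
  moreover have "finite X" by (simp add: X_def)
  ultimately obtain num where num: "bij_betw num X {1..card X}"
      "\<And>C D. C \<in> X \<Longrightarrow> D \<in> X \<Longrightarrow> idx C < idx D \<Longrightarrow> num C < num D"
    using obtain_order_numbering by blast
  have sub: "X \<subseteq> word_cycle ` noncyclic_words k l" using z by (auto simp: X_def)
  have "is_X k l X num"
    unfolding is_X_def using sub strongly_comparable_cycles[OF sub] num by blast
  moreover have "n_good n X num"
    unfolding n_good_def
  proof
    assume "\<exists>S. S \<subseteq> \<Union>X \<and> finite S \<and> card S = n \<and> (\<forall>u\<in>S. \<forall>v\<in>S. \<not> cycle_prec num u v)"
    then obtain S where S: "S \<subseteq> \<Union>X" "finite S" "card S = n"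
      and anti: "\<And>u v. u \<in> S \<Longrightarrow> v \<in> S \<Longrightarrow> \<not> cycle_prec num u v" by blast
    have S_cycle: "word_cycle u \<in> X" "length u = k" if u: "u \<in> S" for u
    proof -
      obtain i where i: "i < h" "u \<in> word_cycle (z i)" using S u by (auto simp: X_def)
      have "word_cycle u = word_cycle (z i)" by (rule word_cycle_eq[OF i(2)])
      then show "word_cycle u \<in> X" using i(1) by (auto simp: X_def)
      show "length u = k"
        using word_cycle_length[OF i(2)] z[OF i(1)] by (simp add: noncyclic_words_def)
    qed
    \<comment> \<open>The antichain from largest to smallest in the list order, which on words of
      equal length agrees with \<open>lex_less\<close>.\<close>
    define vs where "vs = rev (sorted_list_of_set S)"
    have vs: "set vs = S" "length vs = n" using S by (auto simp: vs_def)
    have dec: "sorted_wrt (\<lambda>u v. v < u) vs"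
      by (simp add: vs_def sorted_wrt_rev)
    have less: "lex_less v u" if "u \<in> S" "v \<in> S" "v < u" for u v
    proof -
      have "comparable v u"
        using that S_cycle(2) by (intro comparable_same_length) auto
      moreover have "less_than = {(u, v). u < v}" by auto
      ultimately show ?thesis using that(3) by (simp add: lex_less_def list_less_def)
    qed
    have sorted: "sorted_wrt (\<lambda>u v. lex_less v u) vs"
      by (rule sorted_wrt_mono_rel[OF _ dec]) (simp add: less vs)
    define f where "f u = idx (word_cycle u)" for u
    \<comment> \<open>The antichain condition enters here: the smaller word \<open>v\<close> cannot
      lie in a cycle with a smaller number, so its run is not to the left of the run for
      \<open>u\<close>. Thus decreasing order is also left-to-right order.\<close>
    have "sorted_wrt (\<lambda>u v. f u \<le> f v) vs"
    proof (rule sorted_wrt_mono_rel[OF _ sorted])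
      fix u v assume "u \<in> set vs" "v \<in> set vs" and vu: "lex_less v u"
      then have uv: "u \<in> S" "v \<in> S" using vs by auto
      then have "\<not> num (word_cycle v) < num (word_cycle u)"
        using anti[of v u] vu by (simp add: cycle_prec_def)
      then show "f u \<le> f v"
        using num(2)[of "word_cycle v" "word_cycle u"] S_cycle(1) uv unfolding f_def by force
    qed
    then have "sorted (map f vs)" by (simp add: sorted_wrt_map)
    then have groups: "concat (map (\<lambda>i. filter (\<lambda>v. f v = i) vs) [0..<h]) = vs"
      by (rule concat_filter_fibres) (use idx S_cycle vs in \<open>auto simp: f_def\<close>)
    have "occur_in_order (filter (\<lambda>v. f v = i) vs) (word_power (z i) (m i) @ g i)" if "i < h" for i
    proof -
      let ?us = "filter (\<lambda>v. f v = i) vs"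
      have "u \<in> word_cycle (z i)" if "u \<in> set ?us" for u
        using that idx[of "word_cycle u"] S_cycle(1)[of u] vs word_cycle_self[of u]
        by (auto simp: f_def)
      then have "set ?us \<subseteq> word_cycle (z i)" by blast
      then have "occur_in_order ?us (word_power (z i) (2 * length ?us))"
        by (rule occur_in_order_cyclic_shifts)
      \<comment> \<open>A run receives at most \<open>n\<close> words of the antichain, hence the
        threshold \<open>m > 2n\<close> is large enough.\<close>
      moreover have "2 * length ?us \<le> m i"
        using length_filter_le[of "\<lambda>v. f v = i" vs] vs z[OF that] by linarith
      then have "word_power (z i) (m i)
          = word_power (z i) (2 * length ?us) @ word_power (z i) (m i - 2 * length ?us)"
        by (simp flip: word_power_add)
      ultimately show ?thesis by (simp add: occur_in_order_extend)
    qed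
    then have "list_all2 occur_in_order (map (\<lambda>i. filter (\<lambda>v. f v = i) vs) [0..<h])
        (map (\<lambda>i. word_power (z i) (m i) @ g i) [0..<h])"
      by (simp add: list_all2_conv_all_nth)
    then have "occur_in_order vs (concat (map (\<lambda>i. word_power (z i) (m i) @ g i) [0..<h]))"
      using occur_in_order_refine[OF _ occur_in_order_concat] groups by force
    then have "occur_in_order vs W" by (simp only: W occur_in_order_prepend)
    then show False using occur_in_order_n_divisible[OF _ sorted] ndiv vs by simp
  qed
  ultimately show ?thesis using card_le_beth X_def by blast
qed

section \<open>Counting the selected runs\<close>

text \<open>The break after a run may become visible only inside the next period. Regrouping moves
  that period into the block of the run and keeps the blocks disjoint.\<close>

lemma shift_runs:
  assumes "\<And>i. i \<le> H \<Longrightarrow> 0 < m i"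
  shows "concat (map (\<lambda>i. word_power (z i) (m i) @ g i) [0..<H]) @ z H
       = z 0 @ concat (map (\<lambda>i. word_power (z i) (m i - 1) @ g i @ z (Suc i)) [0..<H])"
  using assms
proof (induction H)
  case (Suc H)
  have "word_power (z H) (m H) = z H @ word_power (z H) (m H - 1)"
    using Suc.prems[of H] by (metis Suc_pred' le_SucI order_refl word_power_Suc)
  then show ?case using Suc by simp
qed simp

lemma n_divisible_extend: "n_divisible n W \<Longrightarrow> n_divisible n (p @ W @ q)"
proof -
  assume "n_divisible n W"
  then obtain W0 Ws where W: "W = W0 @ concat Ws" "length Ws = n"
      "sorted_wrt (\<lambda>u v. lex_less v u) Ws"
    by (auto simp: n_divisible_def)
  then have "occur_in_order Ws (p @ W @ q)"
    by (simp add: occur_in_order_prepend occur_in_order_extend occur_in_order_concat)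
  then show ?thesis using occur_in_order_n_divisible W by blast
qed

text \<open>Every run of the cycle breaks upwards or downwards, which allows at most
  \<open>n - 1\<close> and \<open>n - 2\<close> runs respectively.\<close>

lemma few_runs_per_cycle:
  assumes ndiv: "\<not> n_divisible n (concat (map B [0..<H]))"
    and B: "\<And>i. i < H \<Longrightarrow> B i = word_power (z i) (M i) @ g i @ z (Suc i)"
    and M: "\<And>i. i < H \<Longrightarrow> 2 * n \<le> M i"
    and len: "\<And>i. i \<le> H \<Longrightarrow> length (z i) = k" and "0 < k" "2 \<le> n"
    and nbr: "\<And>i. i < H \<Longrightarrow> z (Suc i) \<notin> word_cycle (z i)"
  shows "card {i. i < H \<and> word_cycle (z i) = word_cycle x} \<le> 2 * n - 3"
proof -
  define I where "I = {i. i < H \<and> word_cycle (z i) = word_cycle x}"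
  define brk where "brk i t \<longleftrightarrow>
    (\<exists>b rest. B i = b @ word_power x (2 * n - 1) @ t @ rest)" for i t
  have brk: "\<exists>t. brk i t \<and> comparable t x" if "i \<in> I" for i
  proof -
    have i: "i < H" "word_cycle (z i) = word_cycle x" using that by (auto simp: I_def)
    then have zx: "z i \<in> word_cycle x" using word_cycle_self by blast
    then have lx: "length x = k" using word_cycle_length len i by fastforce
    have "z (Suc i) \<notin> word_cycle x" "length (z (Suc i)) = length x"
      using nbr i lx len by auto
    moreover have "x \<noteq> []" using lx \<open>0 < k\<close> by auto
    ultimately obtain b J t rest where
      *: "word_power (z i) (Suc (M i - 1)) @ g i @ z (Suc i) = b @ word_power x (M i - 1 + J) @ t @ rest"
      "comparable t x"
      using run_break[OF zx] by metis
    \<comment> \<open>Realignment reduces \<open>M i\<close> to \<open>M i - 1\<close>, still at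
      least \<open>2 * n - 1\<close>, as breaks downwards require. The surplus \<open>e\<close>
      copies are absorbed into the part before the power.\<close>
    define e where "e = M i + J - 2 * n"
    have "M i - 1 + J = e + (2 * n - 1)" "Suc (M i - 1) = M i"
      using M[OF i(1)] \<open>2 \<le> n\<close> by (auto simp: e_def)
    then have "B i = (b @ word_power x e) @ word_power x (2 * n - 1) @ t @ rest"
      using * B[OF i(1)] by (simp add: word_power_add)
    then show ?thesis using * brk_def by blast
  qed
  define U where "U = {i \<in> I. \<exists>t. brk i t \<and> lex_less x t}"
  define L where "L = {i \<in> I. \<exists>t. brk i t \<and> lex_less t x}"
  have "U \<subseteq> {..<H}" "L \<subseteq> {..<H}" by (auto simp: U_def L_def I_def)
  have "card U < n"
  proof (rule few_upper_breaks[OF ndiv \<open>U \<subseteq> {..<H}\<close>])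
    fix i assume "i \<in> U"
    then obtain t b rest where *: "B i = b @ word_power x (2 * n - 1) @ t @ rest" "lex_less x t"
      by (auto simp: U_def brk_def)
    have "2 * n - 1 = (n - 1) + n" using \<open>2 \<le> n\<close> by simp
    then have "B i = (b @ word_power x (n - 1)) @ word_power x n @ t @ rest"
      using * by (simp only: word_power_add append_assoc)
    then show "\<exists>b t rest. B i = b @ word_power x n @ t @ rest \<and> lex_less x t" using * by blast
  qed
  moreover have "card L < n - 1"
    by (rule few_lower_breaks[OF ndiv \<open>L \<subseteq> {..<H}\<close> \<open>2 \<le> n\<close>]) (auto simp: L_def brk_def)
  moreover have "I \<subseteq> U \<union> L" using brk lex_less_total by (fastforce simp: U_def L_def)
  then have "card I \<le> card U + card L"
    using \<open>U \<subseteq> {..<H}\<close> \<open>L \<subseteq> {..<H}\<close> finite_subset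
    by (meson card_Un_le card_mono finite_UnI finite_lessThan le_trans)
  ultimately show ?thesis by (simp add: I_def)
qed

lemma selection_bound:
  assumes sel: "has_selection n (noncyclic_words k l) W h"
    and ndiv: "\<not> n_divisible n W"
    and kn: "0 < k" "k < n" and ne: "noncyclic_words k l \<noteq> {}"
  shows "h < 2 * (n - 1) * beth k l n"
\<comment> \<open>The count below uses two different cycles, so selections of at most one run are
  treated separately, using only that \<open>beth\<close> is positive.\<close>
proof (cases "h \<le> 1")
  case True
  moreover have "0 < beth k l n" using ne beth_pos kn by blast
  then have "2 * 1 * 1 \<le> 2 * (n - 1) * beth k l n" using kn by (intro mult_le_mono) auto
  ultimately show ?thesis by linarith
next
  case False
  then obtain H where h: "h = Suc H" "0 < H" by (cases h) auto
  obtain W0 z m g where W: "W = W0 @ concat (map (\<lambda>i. word_power (z i) (m i) @ g i) [0..<h])"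
    and z: "\<And>i. i < h \<Longrightarrow> z i \<in> noncyclic_words k l \<and> m i > 2 * n"
    and nbr: "\<And>i. Suc i < h \<Longrightarrow> z (Suc i) \<notin> word_cycle (z i)"
    using sel by (auto simp: has_selection_def)
  have len: "length (z i) = k" if "i < h" for i using z[OF that] by (simp add: noncyclic_words_def)
  \<comment> \<open>Each run cedes its first period to the preceding block, so that the blocks contain the breaks.\<close>
  define B where "B i = word_power (z i) (m i - 1) @ g i @ z (Suc i)" for i
  have "m i > 0" if "i \<le> H" for i using z[of i] that h by simp
  then have shift: "concat (map (\<lambda>i. word_power (z i) (m i) @ g i) [0..<H]) @ z H
      = z 0 @ concat (map B [0..<H])"
    unfolding B_def by (rule shift_runs)
  have "word_power (z H) (m H) = z H @ word_power (z H) (m H - 1)"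
    using \<open>\<And>i. i \<le> H \<Longrightarrow> m i > 0\<close>[of H] by (metis Suc_pred' order_refl word_power_Suc)
  then have "W = W0 @ (concat (map (\<lambda>i. word_power (z i) (m i) @ g i) [0..<H]) @ z H)
      @ word_power (z H) (m H - 1) @ g H"
    by (simp add: W h)
  then have "W = (W0 @ z 0) @ concat (map B [0..<H]) @ word_power (z H) (m H - 1) @ g H"
    unfolding shift by simp
  then have ndivB: "\<not> n_divisible n (concat (map B [0..<H]))"
    using ndiv n_divisible_extend by metis
  define X where "X = word_cycle ` z ` {..<h}"
  have N: "card X \<le> beth k l n"
    unfolding X_def using card_cycles_le_beth[OF W z ndiv] by blast
  \<comment> \<open>Two neighbouring runs already show two cycles; this makes the final inequality
    strict.\<close>
  have "word_cycle (z 0) \<noteq> word_cycle (z 1)"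
    using nbr[of 0] h word_cycle_self[of "z 1"] by auto
  moreover have "{word_cycle (z 0), word_cycle (z 1)} \<subseteq> X" using h by (auto simp: X_def)
  then have "card {word_cycle (z 0), word_cycle (z 1)} \<le> card X"
    by (rule card_mono[rotated]) (simp add: X_def)
  ultimately have N2: "2 \<le> card X" by simp
  have per_cycle: "card {i. i < H \<and> word_cycle (z i) = C} \<le> 2 * n - 3" if "C \<in> X" for C
  proof -
    obtain x where "C = word_cycle x" using \<open>C \<in> X\<close> by (auto simp: X_def)
    moreover have "2 * n \<le> m i - 1" if "i < H" for i using z[of i] that h by linarith
    ultimately show ?thesis
      using few_runs_per_cycle[OF ndivB B_def, of k x] len nbr h kn by auto
  qed
  \<comment> \<open>Only the first \<open>H = h - 1\<close> runs are counted, as the last one need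
    not be followed by a break.\<close>
  have "word_cycle (z i) \<in> X" if "i < H" for i using that h by (simp add: X_def)
  then have "{..<H} = (\<Union>C\<in>X. {i. i < H \<and> word_cycle (z i) = C})" by auto
  then have "H \<le> (\<Sum>C\<in>X. card {i. i < H \<and> word_cycle (z i) = C})"
    using card_UN_le[of X "\<lambda>C. {i. i < H \<and> word_cycle (z i) = C}"]
    by (metis X_def card_lessThan finite_imageI finite_lessThan)
  also have "\<dots> \<le> card X * (2 * n - 3)"
    using sum_bounded_above[of X, OF per_cycle] by simp
  \<comment> \<open>Adding \<open>card X\<close> turns the factor \<open>2 * n - 3\<close> into
    \<open>2 * (n - 1)\<close>, and since \<open>card X\<close> is at least 2, the left side exceeds
    \<open>h = Suc H\<close>.\<close>
  finally have "H + card X \<le> card X * (2 * n - 3) + card X" by simp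
  also have "\<dots> = card X * (2 * (n - 1))"
    using kn by (simp add: algebra_simps flip: mult_Suc_right)
  finally have "h < card X * (2 * (n - 1))" using N2 h by linarith
  also have "\<dots> \<le> 2 * (n - 1) * beth k l n" using N by (simp add: mult.commute)
  finally show ?thesis .
qed

theorem mainTheorem7:
  fixes scale :: "'k::comm_ring_1 \<Rightarrow> 'a::ring \<Rightarrow> 'a"
    and a :: "nat \<Rightarrow> 'a"
    and f :: "nat list \<Rightarrow>\<^sub>0 'k"
    and k n l :: nat
  assumes "assoc_algebra scale"
    and "generated_by scale (a ` {1..l})"
    and "admissible_poly n f"
    and "satisfies_identity scale f"
    and "0 < k" and "k < n"
    and "noncyclic_words k l \<noteq> {}"
  shows "algebra_selective_height l n (noncyclic_words k l) < enat (2 * (n - 1) * beth k l n)"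
proof -
  define b where "b = 2 * (n - 1) * beth k l n"
  have "0 < b"
    using assms(5-7) beth_pos by (fastforce simp: b_def)
  \<comment> \<open>A supremum of numbers below \<open>b\<close> need not itself be below
    \<open>b\<close> in general, so the strict bound is passed through it as \<open>b - 1\<close>,
    which lies below \<open>b\<close> because \<open>b\<close> is positive.\<close>
  have "h \<le> b - 1" if "\<not> n_divisible n W" "has_selection n (noncyclic_words k l) W h" for W h
    using selection_bound[OF that(2,1) assms(5-7)] by (simp add: b_def)
  then have "algebra_selective_height l n (noncyclic_words k l) \<le> enat (b - 1)"
    unfolding algebra_selective_height_def set_selective_height_def word_selective_height_def
    by (intro SUP_least) auto
  also have "\<dots> < enat b" using \<open>0 < b\<close> by simp
  finally show ?thesis by (simp add: b_def)
qed

end
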